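(* Let $F$ be a marked, weighted graph with an unlooped, unmarked vertex $a$ that has standard weights. Then there are weights $\alpha'(a),\beta'(a),\alpha'(a_m)\in R$ that depend only on $F$ and $a$, and have the following universal property: every composition $F\ast H$ with a marked, weighted graph $H$ (with $V(F)\cap V(H)=\{a\}$) in which no neighbor of $a$ is marked has $$[F\ast H]=[H']+[H'_m],$$ where $H'$ is obtained from $H$ by changing the weights of $a$ to $\alpha'(a)$ and $\beta'(a)$, and $H'_m$ is obtained from $H$ by marking $a$ and changing its weights to $\alpha'(a_m)$ and $\beta'(a_m)=0$.
   Context: A graph $G=(V(G),E(G))$ is finite and may have loops, multiple edges, and free loops (connected components that contain neither vertices nor edges). A marked graph is a graph each of whose vertices is designated either marked or unmarked. A weighted, marked graph is a marked graph given with functions $\alpha,\beta:V(G)\to R$, where $R$ is a fixed commutative ring containing elements $A,B,d$. A vertex $v$ has standard weights if $\alpha(v)=A$ and $\beta(v)=B$. If $V(G)=\{v_1,\dots,v_n\}$, the Boolean adjacency matrix $\mathcal{A}(G)$ is the $n\times n$ matrix over $GF(2)$ with $\mathcal{A}(G)_{ii}=1$ iff $v_i$ is looped and, for $i\neq j$, $\mathcal{A}(G)_{ij}=1$ iff $v_i$ and $v_j$ are adjacent. For $T\subseteq V(G)$, $\mathcal{A}(G)_T$ is obtained from $\mathcal{A}(G)$ by first changing the $i$th diagonal entry whenever $v_i\in T$, and then removing the $i$th row and column whenever $v_i$ is marked and the (new) $i$th diagonal entry is $0$. The weighted marked-graph bracket polynomial is $$[G]=d^{\phi}\sum_{T\subseteq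 V(G)}\Big(\prod_{v\notin T}\alpha(v)\Big)\Big(\prod_{t\in T}\beta(t)\Big)d^{\nu(\mathcal{A}(G)_T)},$$ where $\phi$ is the number of free loops of $G$ and $\nu$ is the $GF(2)$-nullity (the empty matrix has nullity $0$). Composition: a marked, weighted graph $G$ is the composition $F\ast H$ of marked, weighted graphs $F$ and $H$ if: (a) $V(F)\cap V(H)$ consists of a single unlooped, unmarked vertex $a$ that has standard weights in both $F$ and $H$; (b) the elements of $V(G)=V(F)\cup V(H)-\{a\}$ inherit their loops, marks and weights from $F$ and $H$; (c) $E(G)=E(F-a)\cup E(H-a)\cup\{\{v,w\} : \{v,a\}\in E(F)\text{ and }\{a,w\}\in E(H)\}$; (d) $F$ and $H$ do not share any free loop, and the free loops of $G$ are those of $F$ and $H$. Here $G-v$ denotes the result of removing $v$ and all edges incident on $v$. *)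

theory Defs
  imports
    "HOL-Library.Multiset"
    "HOL-Library.Z2"
    "Jordan_Normal_Form.Matrix_Kernel"
    "Jordan_Normal_Form.DL_Submatrix"
begin

text \<open>
  An edge is represented by the set of its ends, so that a loop at \<open>v\<close> is an occurrence of
  \<open>{v}\<close>; the multiset records multiple edges. Free loops are kept as a set of named
  objects, so that it makes sense for two graphs not to share any of them. The values of the
  weight functions outside the vertex set carry no meaning.
\<close>

record ('v, 'l, 'r) wm_graph =
  verts :: "'v set"
  edges :: "'v set multiset"
  free_loops :: "'l set"
  marked :: "'v set"
  alpha :: "'v \<Rightarrow> 'r"
  beta :: "'v \<Rightarrow> 'r"

definition wf_wm_graph :: "('v, 'l, 'r) wm_graph \<Rightarrow> bool" where
  "wf_wm_graph G \<longleftrightarrow>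
     finite (verts G) \<and> finite (free_loops G) \<and> marked G \<subseteq> verts G \<and>
     (\<forall>e. e \<in># edges G \<longrightarrow> e \<subseteq> verts G \<and> (card e = 1 \<or> card e = 2))"

definition looped :: "('v, 'l, 'r) wm_graph \<Rightarrow> 'v \<Rightarrow> bool" where
  "looped G v \<longleftrightarrow> {v} \<in># edges G"

definition neighbor :: "('v, 'l, 'r) wm_graph \<Rightarrow> 'v \<Rightarrow> 'v \<Rightarrow> bool" where
  "neighbor G v w \<longleftrightarrow> v \<noteq> w \<and> {v, w} \<in># edges G"

definition standard_weights :: "'r \<Rightarrow> 'r \<Rightarrow> ('v, 'l, 'r) wm_graph \<Rightarrow> 'v \<Rightarrow> bool" where
  "standard_weights A B G v \<longleftrightarrow> alpha G v = A \<and> beta G v = B"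

definition adjacency_matrix :: "('v, 'l, 'r) wm_graph \<Rightarrow> 'v list \<Rightarrow> bit mat" where
  "adjacency_matrix G vs = mat (length vs) (length vs) (\<lambda>(i, j).
     of_bool (if i = j then looped G (vs ! i) else neighbor G (vs ! i) (vs ! j)))"

text \<open>Over \<open>GF(2)\<close>, changing a diagonal entry means adding 1 to it.\<close>

definition toggle_diagonal :: "bit mat \<Rightarrow> 'v list \<Rightarrow> 'v set \<Rightarrow> bit mat" where
  "toggle_diagonal M vs T = mat (dim_row M) (dim_col M) (\<lambda>(i, j).
     if i = j \<and> vs ! i \<in> T then M $$ (i, j) + 1 else M $$ (i, j))"

definition adjacency_matrix_at ::
    "('v, 'l, 'r) wm_graph \<Rightarrow> 'v list \<Rightarrow> 'v set \<Rightarrow> bit mat" where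
  "adjacency_matrix_at G vs T =
     (let M = toggle_diagonal (adjacency_matrix G vs) vs T;
          I = {i. i < length vs \<and> \<not> (vs ! i \<in> marked G \<and> M $$ (i, i) = 0)}
      in submatrix M I I)"

text \<open>
  The nullities below do not depend on the chosen enumeration, since another one conjugates the
  matrices by permutations.
\<close>

definition vertex_enum :: "('v, 'l, 'r) wm_graph \<Rightarrow> 'v list" where
  "vertex_enum G = (SOME vs. distinct vs \<and> set vs = verts G)"

definition bracket :: "'r \<Rightarrow> ('v, 'l, 'r::comm_ring_1) wm_graph \<Rightarrow> 'r" where
  "bracket d G = d ^ card (free_loops G) *
     (\<Sum>T\<in>Pow (verts G).
        (\<Prod>v\<in>verts G - T. alpha G v) * (\<Prod>t\<in>T. beta G t) *
        d ^ kernel_dim (adjacency_matrix_at G (vertex_enum G) T))"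

definition del_vertex :: "('v, 'l, 'r) wm_graph \<Rightarrow> 'v \<Rightarrow> ('v, 'l, 'r) wm_graph" where
  "del_vertex G v = G\<lparr>verts := verts G - {v},
                      edges := filter_mset (\<lambda>e. v \<notin> e) (edges G),
                      marked := marked G - {v}\<rparr>"

definition plain_vertex :: "'r \<Rightarrow> 'r \<Rightarrow> ('v, 'l, 'r) wm_graph \<Rightarrow> 'v \<Rightarrow> bool" where
  "plain_vertex A B G a \<longleftrightarrow>
     a \<in> verts G \<and> \<not> looped G a \<and> a \<notin> marked G \<and> standard_weights A B G a"

text \<open>
  \<open>G\<close> is a composition of \<open>F\<close> and \<open>H\<close> at \<open>a\<close>. The set of pairs
  joined by the new edges \<open>N\<close> is prescribed, but not the multiplicities in \<open>N\<close>:
  both the convention of one new edge for each pair and that of one new edge for each pair of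
  old edges are instances.
\<close>

definition is_composition ::
    "'r \<Rightarrow> 'r \<Rightarrow> 'v \<Rightarrow> ('v, 'l, 'r) wm_graph \<Rightarrow> ('v, 'l, 'r) wm_graph \<Rightarrow> ('v, 'l, 'r) wm_graph \<Rightarrow> bool"
  where
  "is_composition A B a F H G \<longleftrightarrow>
     wf_wm_graph F \<and> wf_wm_graph H \<and> wf_wm_graph G \<and>
     verts F \<inter> verts H = {a} \<and> plain_vertex A B F a \<and> plain_vertex A B H a \<and>
     verts G = (verts F \<union> verts H) - {a} \<and>
     marked G = marked F \<union> marked H \<and>
     (\<forall>v\<in>verts F - {a}. alpha G v = alpha F v \<and> beta G v = beta F v) \<and>
     (\<forall>v\<in>verts H - {a}. alpha G v = alpha H v \<and> beta G v = beta H v) \<and>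
     (\<exists>N. edges G = edges (del_vertex F a) + edges (del_vertex H a) + N \<and>
          set_mset N = {{v, w} |v w. {v, a} \<in># edges F \<and> {a, w} \<in># edges H}) \<and>
     free_loops F \<inter> free_loops H = {} \<and> free_loops G = free_loops F \<union> free_loops H"

definition set_weights ::
    "('v, 'l, 'r) wm_graph \<Rightarrow> 'v \<Rightarrow> 'r \<Rightarrow> 'r \<Rightarrow> ('v, 'l, 'r) wm_graph" where
  "set_weights G v x y = G\<lparr>alpha := (alpha G)(v := x), beta := (beta G)(v := y)\<rparr>"

definition mark_vertex :: "('v, 'l, 'r) wm_graph \<Rightarrow> 'v \<Rightarrow> ('v, 'l, 'r) wm_graph" where
  "mark_vertex G v = G\<lparr>marked := insert v (marked G)\<rparr>"

end

theory Submission
  imports Defs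
begin

text \<open>
  Split a subset of \<open>V(G)\<close> into its parts in \<open>F - a\<close> and \<open>H - a\<close>. The matrix of the
  composition then has diagonal blocks \<open>M\<close> and \<open>P\<close> coming from \<open>F - a\<close> and \<open>H - a\<close>, and
  off-diagonal blocks \<open>x y\<^sup>T\<close> and \<open>y x\<^sup>T\<close>, where \<open>x\<close> and \<open>y\<close> are the indicators of the
  neighbors of \<open>a\<close>. Three cases depend on \<open>M\<close> and \<open>x\<close> alone. If \<open>x\<close> is not orthogonal to
  \<open>ker M\<close>, the nullity is \<open>\<nu>(M) - 1\<close> plus that of \<open>P\<close> bordered by \<open>y\<close> with corner 0.
  Otherwise \<open>x = M u\<close> because \<open>M\<close> is symmetric, and the nullity is \<open>\<nu>(M)\<close> plus that of \<open>P\<close>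
  bordered by \<open>y\<close> with corner 1 if \<open>x \<cdot> u = 1\<close>, and \<open>\<nu>(M)\<close> plus \<open>\<nu>(P)\<close> if \<open>x \<cdot> u = 0\<close>.
  These are the matrices of \<open>H\<close> with \<open>a\<close> not toggled, with \<open>a\<close> toggled, and with \<open>a\<close> marked
  and not toggled, so the three cases contribute to \<open>\<alpha>'(a)\<close>, \<open>\<beta>'(a)\<close> and \<open>\<alpha>'(a\<^sub>m)\<close>
  respectively. Nullities over \<open>GF(2)\<close> are compared by counting kernels.
\<close>

section \<open>Nullity over GF(2)\<close>

text \<open>
  These simplification rules would rewrite the field operations of \<open>GF(2)\<close> to bitwise ones.
\<close>

declare add_bit_eq_xor [simp del] mult_bit_eq_and [simp del]

lemma bit_add_self [simp]: "b + b = 0" for b :: bit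
  by (cases b) simp_all

lemma bit_add_self_left [simp]: "b + (b + c) = c" for b c :: bit
  by (simp flip: add.assoc)

section \<open>Counting kernels of matrices\<close>

lemma card_UNIV_bit: "card (UNIV :: bit set) = 2"
proof -
  have "(UNIV :: bit set) = {0, 1}" using bit_not_zero_iff by blast
  then show ?thesis by (metis card_2_iff zero_neq_one)
qed

text \<open>Each kernel vector is a unique combination of basis vectors with coefficients in a field
  of two elements, so the coefficient functions on a basis count the kernel. Equalities between
  nullities thereby become equalities between cardinalities.\<close>

lemma card_mat_kernel:
  fixes M :: "bit mat"
  shows "card (mat_kernel M) = 2 ^ kernel_dim M"
proof -
  define nr nc where "nr = dim_row M" and "nc = dim_col M"
  have M: "M \<in> carrier_mat nr nc"
    unfolding nr_def nc_def by auto
  interpret K: kernel nr nc M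
    by unfold_locales (rule M)
  obtain Bs where fin: "finite Bs" and basis: "K.basis Bs"
    using kernel_basis_exists[OF M] by auto
  have sub: "Bs \<subseteq> mat_kernel M"
    using basis K.Ker.basis_def by auto
  have ex1: "\<exists>!c. c \<in> Bs \<rightarrow>\<^sub>E UNIV \<and> K.lincomb c Bs = v" if "v \<in> mat_kernel M" for v
    using K.Ker.basis_criterion[OF fin sub] basis that by auto
  have closed: "K.lincomb c Bs \<in> mat_kernel M" for c
    using K.Ker.lincomb_closed[OF sub, of c] by auto
  have "bij_betw (\<lambda>c. K.lincomb c Bs) (Bs \<rightarrow>\<^sub>E UNIV) (mat_kernel M)"
    unfolding bij_betw_def inj_on_def
  proof (intro conjI ballI impI equalityI subsetI)
    fix c c' assume "c \<in> Bs \<rightarrow>\<^sub>E UNIV" "c' \<in> Bs \<rightarrow>\<^sub>E UNIV" "K.lincomb c Bs = K.lincomb c' Bs"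
    then show "c = c'" using ex1[OF closed[of c]] by metis
  next
    fix v assume "v \<in> (\<lambda>c. K.lincomb c Bs) ` (Bs \<rightarrow>\<^sub>E UNIV)"
    then show "v \<in> mat_kernel M" using closed by auto
  next
    fix v assume "v \<in> mat_kernel M"
    then show "v \<in> (\<lambda>c. K.lincomb c Bs) ` (Bs \<rightarrow>\<^sub>E UNIV)"
      using ex1[of v] by (metis imageI)
  qed
  then have "card (mat_kernel M) = card (Bs \<rightarrow>\<^sub>E (UNIV :: bit set))"
    by (simp add: bij_betw_same_card)
  also have "\<dots> = 2 ^ card Bs"
    using fin by (simp add: card_PiE card_UNIV_bit)
  also have "card Bs = kernel_dim M"
    using K.Ker.dim_basis[OF fin basis] by simp
  finally show ?thesis .
qed

text \<open>Vectors are indexed by vertices, so that deleting or joining index sets needs no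
  enumeration. The fixed value 0 outside \<open>S\<close> makes equal vectors equal functions, as
  counting requires.\<close>

definition supported :: "'v set \<Rightarrow> ('v \<Rightarrow> bit) set" where
  "supported S = {f. \<forall>v. v \<notin> S \<longrightarrow> f v = 0}"

definition null_space :: "'v set \<Rightarrow> ('v \<Rightarrow> 'v \<Rightarrow> bit) \<Rightarrow> ('v \<Rightarrow> bit) set" where
  "null_space S m = {f \<in> supported S. \<forall>v\<in>S. (\<Sum>w\<in>S. m v w * f w) = 0}"

text \<open>Reading a function along the enumeration \<open>g\<close> gives a vector, and the
  inverse pads a vector with 0 outside \<open>S\<close>. The sums in the kernel equations are
  reindexed along \<open>g\<close>.\<close>

lemma card_mat_kernel_eq_null_space:
  fixes M :: "bit mat"
  assumes M: "M \<in> carrier_mat n n"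
    and g: "bij_betw g {..<n} S"
    and entries: "\<And>i j. i < n \<Longrightarrow> j < n \<Longrightarrow> M $$ (i, j) = m (g i) (g j)"
  shows "card (mat_kernel M) = card (null_space S m)"
proof -
  have gS: "g i \<in> S" if "i < n" for i using g that by (auto simp: bij_betw_def)
  have inv: "inv_into {..<n} g (g i) = i" if "i < n" for i
    using g that by (auto simp: bij_betw_def)
  have inv': "g (inv_into {..<n} g v) = v" "inv_into {..<n} g v < n" if "v \<in> S" for v
    using g that inv_into_into[of v g "{..<n}"] by (auto simp: bij_betw_def f_inv_into_f)
  have sum: "(M *\<^sub>v vec n (\<lambda>i. f (g i))) $ i = (\<Sum>w\<in>S. m (g i) w * f w)" if "i < n" for f i
  proof -
    have "(M *\<^sub>v vec n (\<lambda>i. f (g i))) $ i = (\<Sum>j<n. m (g i) (g j) * f (g j))"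
      using that M entries by (auto simp: scalar_prod_def atLeast0LessThan intro!: sum.cong)
    also have "\<dots> = (\<Sum>w\<in>S. m (g i) w * f w)"
      by (rule sum.reindex_bij_betw[OF g])
    finally show ?thesis .
  qed
  have kernel_iff: "vec n (\<lambda>i. f (g i)) \<in> mat_kernel M \<longleftrightarrow> (\<forall>v\<in>S. (\<Sum>w\<in>S. m v w * f w) = 0)" for f
  proof -
    have "vec n (\<lambda>i. f (g i)) \<in> mat_kernel M \<longleftrightarrow> (\<forall>i<n. (\<Sum>w\<in>S. m (g i) w * f w) = 0)"
      unfolding mat_kernel[OF M] using M by (auto simp: vec_eq_iff sum simp del: index_mult_mat_vec)
    also have "\<dots> \<longleftrightarrow> (\<forall>v\<in>S. (\<Sum>w\<in>S. m v w * f w) = 0)"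
      using gS inv' by metis
    finally show ?thesis .
  qed
  have "bij_betw (\<lambda>f. vec n (\<lambda>i. f (g i))) (null_space S m) (mat_kernel M)"
  proof (rule bij_betw_byWitness[where
        f' = "\<lambda>x v. if v \<in> S then x $ inv_into {..<n} g v else 0"])
    show "\<forall>f\<in>null_space S m. (\<lambda>v. if v \<in> S then vec n (\<lambda>i. f (g i)) $ inv_into {..<n} g v else 0) = f"
      by (auto simp: null_space_def supported_def inv' fun_eq_iff)
    show eq: "\<forall>x\<in>mat_kernel M. vec n (\<lambda>i. if g i \<in> S then x $ inv_into {..<n} g (g i) else 0) = x"
      by (auto simp: vec_eq_iff gS inv dest!: mat_kernelD(1)[OF M])
    show "(\<lambda>f. vec n (\<lambda>i. f (g i))) ` null_space S m \<subseteq> mat_kernel M"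
      using kernel_iff by (auto simp: null_space_def)
    show "(\<lambda>x v. if v \<in> S then x $ inv_into {..<n} g v else 0) ` mat_kernel M \<subseteq> null_space S m"
    proof clarify
      fix x assume x: "x \<in> mat_kernel M"
      let ?f = "\<lambda>v. if v \<in> S then x $ inv_into {..<n} g v else 0"
      have "vec n (\<lambda>i. ?f (g i)) \<in> mat_kernel M"
        using eq x by simp
      then have "\<forall>v\<in>S. (\<Sum>w\<in>S. m v w * ?f w) = 0"
        by (rule kernel_iff[THEN iffD1])
      then show "?f \<in> null_space S m"
        unfolding null_space_def supported_def by simp
    qed
  qed
  then show ?thesis by (simp add: bij_betw_same_card)
qed

text \<open>The exponent is unique whenever it exists; for finite \<open>S\<close> it exists by
  \<open>card_null_space\<close>.\<close>

definition nullity :: "'v set \<Rightarrow> ('v \<Rightarrow> 'v \<Rightarrow> bit) \<Rightarrow> nat" where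
  "nullity S m = (THE k. card (null_space S m) = 2 ^ k)"

lemma nullity_eqI: "card (null_space S m) = 2 ^ k \<Longrightarrow> nullity S m = k"
  unfolding nullity_def by (intro the_equality) auto

text \<open>An enumeration of \<open>S\<close> turns \<open>m\<close> into a matrix, and the
  cardinality of its kernel is a power of 2.\<close>

lemma card_null_space:
  assumes "finite S"
  shows "card (null_space S m) = 2 ^ nullity S m"
proof -
  obtain g where g: "bij_betw g {..<card S} S"
    using ex_bij_betw_nat_finite[OF assms] by (metis atLeast0LessThan)
  let ?M = "mat (card S) (card S) (\<lambda>(i, j). m (g i) (g j))"
  have "card (mat_kernel ?M) = card (null_space S m)"
    by (rule card_mat_kernel_eq_null_space[OF _ g]) auto
  then have "card (null_space S m) = 2 ^ kernel_dim ?M"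
    by (simp add: card_mat_kernel)
  then show ?thesis using nullity_eqI by metis
qed

lemma null_space_cong:
  assumes "\<And>v w. v \<in> S \<Longrightarrow> w \<in> S \<Longrightarrow> m v w = m' v w"
  shows "null_space S m = null_space S m'"
  using assms by (auto simp: null_space_def cong: sum.cong)

lemma nullity_cong:
  assumes "\<And>v w. v \<in> S \<Longrightarrow> w \<in> S \<Longrightarrow> m v w = m' v w"
  shows "nullity S m = nullity S m'"
  using null_space_cong[of S m m', OF assms] by (simp add: nullity_def)

text \<open>\<open>submatrix\<close> selects rows and columns through \<open>pick\<close>, which is
  strictly increasing below \<open>card I\<close>. Being injective into the finite set
  \<open>I\<close>, it reaches all of \<open>I\<close> by cardinality.\<close>

lemma bij_betw_pick:
  assumes "I \<subseteq> {..<n}"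
  shows "bij_betw (pick I) {..<card I} I"
proof -
  have fin: "finite I" using assms finite_subset by blast
  have mem: "pick I i \<in> I" if "i < card I" for i using pick_in_set_le that by auto
  have "inj_on (pick I) {..<card I}"
    by (intro linorder_inj_onI) (auto dest!: pick_mono_le[of _ I])
  moreover have "pick I ` {..<card I} = I"
    using calculation fin mem by (intro card_subset_eq) (auto simp: card_image)
  ultimately show ?thesis by (simp add: bij_betw_def)
qed

section \<open>Solvability of symmetric linear systems over GF(2)\<close>

lemma finite_supported:
  assumes "finite S"
  shows "finite (supported S)"
proof (rule finite_subset)
  show "supported S \<subseteq> {f. \<forall>v. (v \<in> S \<longrightarrow> f v \<in> {0, 1}) \<and> (v \<notin> S \<longrightarrow> f v = 0)}"
    by (auto simp: supported_def)
  show "finite {f. \<forall>v. (v \<in> S \<longrightarrow> f v \<in> {0, 1 :: bit}) \<and> (v \<notin> S \<longrightarrow> f v = 0)}"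
    by (rule finite_set_of_finite_funs) (use assms in auto)
qed

text \<open>Translation by \<open>t\<close> permutes the supported vectors and changes
  \<open>h\<close> by 1, hence negates every sign. The integer sum is therefore its own
  negative.\<close>

lemma sum_sign_flip:
  fixes h :: "('v \<Rightarrow> bit) \<Rightarrow> bit"
  assumes "t \<in> supported S" and "h t = 1"
    and "\<And>f. f \<in> supported S \<Longrightarrow> h (\<lambda>v. f v + t v) = h f + h t"
  shows "(\<Sum>f\<in>supported S. if h f = 0 then 1 else - 1 :: int) = 0"
proof -
  let ?s = "\<lambda>f. if h f = 0 then 1 else - 1 :: int"
  have "bij_betw (\<lambda>f v. f v + t v) (supported S) (supported S)"
    by (rule bij_betw_byWitness[where f' = "\<lambda>f v. f v + t v"])
       (use assms(1) in \<open>auto simp: supported_def add.assoc\<close>)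
  from sum.reindex_bij_betw[OF this, of ?s]
  have "sum ?s (supported S) = (\<Sum>f\<in>supported S. ?s (\<lambda>v. f v + t v))" by simp
  also have "\<dots> = (\<Sum>f\<in>supported S. - ?s f)"
    using assms by (intro sum.cong) auto
  finally show ?thesis by (simp add: sum_negf)
qed

text \<open>
  Sum the signs \<open>(-1) ^ (p \<cdot> (m u + x))\<close> over all pairs \<open>(u, p)\<close>. Summing over \<open>u\<close> first gives
  a positive total, while summing over \<open>p\<close> first gives 0 unless \<open>m u = x\<close> for some \<open>u\<close>.
\<close>

lemma fredholm_alternative:
  fixes m :: "'v \<Rightarrow> 'v \<Rightarrow> bit"
  assumes fin: "finite S"
    and sym: "\<And>v w. v \<in> S \<Longrightarrow> w \<in> S \<Longrightarrow> m v w = m w v"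
    and orth: "\<And>p. p \<in> null_space S m \<Longrightarrow> (\<Sum>v\<in>S. x v * p v) = 0"
  obtains u where "u \<in> supported S" "\<And>v. v \<in> S \<Longrightarrow> (\<Sum>w\<in>S. m v w * u w) = x v"
proof (rule ccontr)
  assume "\<not> thesis"
  then have no: "\<exists>v\<in>S. (\<Sum>w\<in>S. m v w * u w) \<noteq> x v" if "u \<in> supported S" for u
    using \<open>\<And>u. u \<in> supported S \<Longrightarrow> (\<And>v. v \<in> S \<Longrightarrow> (\<Sum>w\<in>S. m v w * u w) = x v) \<Longrightarrow> thesis\<close> that
    by blast
  define h where "h p u = (\<Sum>v\<in>S. p v * ((\<Sum>w\<in>S. m v w * u w) + x v))" for p u :: "'v \<Rightarrow> bit"
  define s where "s b = (if b = 0 then 1 else - 1 :: int)" for b :: bit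
  \<comment> \<open>By definition \<open>h\<close> is linear in \<open>p\<close>. Symmetry moves
    \<open>m\<close> to the other factor and shows that \<open>h\<close> is affine in
    \<open>u\<close>, with linear part given by \<open>m p\<close>.\<close>
  have h_alt: "h p u = (\<Sum>w\<in>S. (\<Sum>v\<in>S. m w v * p v) * u w) + (\<Sum>v\<in>S. x v * p v)" for p u
  proof -
    have "h p u = (\<Sum>v\<in>S. \<Sum>w\<in>S. m v w * p v * u w) + (\<Sum>v\<in>S. x v * p v)"
      by (simp add: h_def distrib_left sum.distrib sum_distrib_left mult_ac)
    also have "(\<Sum>v\<in>S. \<Sum>w\<in>S. m v w * p v * u w) = (\<Sum>w\<in>S. \<Sum>v\<in>S. m w v * p v * u w)"
      by (subst sum.swap) (auto simp: sym intro!: sum.cong)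
    finally show ?thesis by (simp add: sum_distrib_right)
  qed
  have unit: "(\<lambda>w. of_bool (w = v)) \<in> supported S" if "v \<in> S" for v
    using that by (auto simp: supported_def)
  \<comment> \<open>Some entry of \<open>m u + x\<close> is 1, and adding the unit vector at that
    position to \<open>p\<close> flips the sign.\<close>
  have row_sum: "(\<Sum>p\<in>supported S. s (h p u)) = 0" if u: "u \<in> supported S" for u
  proof -
    obtain v where v: "v \<in> S" "(\<Sum>w\<in>S. m v w * u w) \<noteq> x v"
      using no[OF u] by blast
    have "(\<Sum>w\<in>S. m v w * u w) + x v = 1"
      using v(2) by (cases "\<Sum>w\<in>S. m v w * u w"; cases "x v") auto
    then have one: "h (\<lambda>w. of_bool (w = v)) u = 1"
      using v fin by (simp add: h_def sum_of_bool_mult_eq Int_absorb1)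
    have "h (\<lambda>v. f v + t v) u = h f u + h t u" for f t
      by (simp only: h_def distrib_right sum.distrib)
    from sum_sign_flip[of _ S "\<lambda>p. h p u", OF unit[OF v(1)] one this]
    show ?thesis by (simp add: s_def)
  qed
  have zero: "(\<lambda>v. 0) \<in> null_space S m"
    by (simp add: null_space_def supported_def)
  \<comment> \<open>For \<open>p\<close> in the null space, \<open>h p u\<close> is the constant
    \<open>x \<cdot> p\<close>, which is 0. Otherwise \<open>m p\<close> has an entry 1, and the
    unit vector there, added to \<open>u\<close>, flips the sign.\<close>
  have col_sum: "(\<Sum>u\<in>supported S. s (h p u)) = (if p \<in> null_space S m then int (card (supported S)) else 0)"
    if p: "p \<in> supported S" for p
  proof (cases "p \<in> null_space S m")
    case True
    then have "h p u = 0" for u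
      using orth[OF True] by (simp add: h_alt null_space_def)
    then show ?thesis using True by (simp add: s_def)
  next
    case False
    then obtain v where v: "v \<in> S" "(\<Sum>w\<in>S. m v w * p w) = 1"
      using p by (auto simp: null_space_def)
    let ?r = "\<lambda>u. (\<Sum>w\<in>S. (\<Sum>v\<in>S. m w v * p v) * u w)"
    let ?c = "\<Sum>v\<in>S. x v * p v"
    have one: "?r (\<lambda>w. of_bool (w = v)) = 1"
      using v fin by (simp add: sum_mult_of_bool_eq Int_absorb1)
    have "?r (\<lambda>v. f v + t v) = ?r f + ?r t" for f t
      by (simp only: distrib_left sum.distrib)
    from sum_sign_flip[of _ S ?r, OF unit[OF v(1)] one this]
    have "(\<Sum>u\<in>supported S. s (?r u)) = 0" by (simp add: s_def)
    \<comment> \<open>The constant \<open>?c\<close> thus contributes only a factor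
      \<open>s ?c\<close>, which leaves the sum.\<close>
    moreover have "s (a + b) = s b * s a" for a b
      by (cases a; cases b) (simp_all add: s_def)
    ultimately show ?thesis
      using False by (simp add: h_alt flip: sum_distrib_left)
  qed
  have "0 = (\<Sum>u\<in>supported S. \<Sum>p\<in>supported S. s (h p u))"
    using row_sum by simp
  also have "\<dots> = (\<Sum>p\<in>supported S. \<Sum>u\<in>supported S. s (h p u))"
    by (rule sum.swap)
  also have "\<dots> = (\<Sum>p\<in>supported S. if p \<in> null_space S m then int (card (supported S)) else 0)"
    using col_sum by simp
  \<comment> \<open>The zero vector lies in the null space, so one summand is positive.\<close>
  also have "\<dots> > 0"
  proof (rule sum_pos2[where i = "\<lambda>v. 0"])
    show "0 < (if (\<lambda>v. 0) \<in> null_space S m then int (card (supported S)) else 0)"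
      using zero finite_supported[OF fin] by (auto simp: null_space_def card_gt_0_iff)
  qed (use zero finite_supported[OF fin] in \<open>auto simp: null_space_def\<close>)
  finally show False by simp
qed

section \<open>The nullity of a block matrix\<close>

text \<open>Every index outside \<open>S\<close> counts as part of the second block. The
  off-diagonal blocks have rank at most 1 because each neighbor of \<open>a\<close> on one side is
  joined to each neighbor of \<open>a\<close> on the other.\<close>

definition block :: "'v set \<Rightarrow> ('v \<Rightarrow> 'v \<Rightarrow> bit) \<Rightarrow> ('v \<Rightarrow> bit) \<Rightarrow> ('v \<Rightarrow> 'v \<Rightarrow> bit) \<Rightarrow> ('v \<Rightarrow> bit) \<Rightarrow> 'v \<Rightarrow> 'v \<Rightarrow> bit"
  where "block S m x m' y v w =
    (if v \<in> S then if w \<in> S then m v w else x v * y w else if w \<in> S then y v * x w else m' v w)"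

text \<open>This puts \<open>a\<close> back into the matrix of \<open>H - a\<close>:
  \<open>y\<close> marks its neighbors, and the corner \<open>c\<close> tells whether
  \<open>a\<close> is toggled.\<close>

definition bordered :: "'v \<Rightarrow> bit \<Rightarrow> ('v \<Rightarrow> bit) \<Rightarrow> ('v \<Rightarrow> 'v \<Rightarrow> bit) \<Rightarrow> 'v \<Rightarrow> 'v \<Rightarrow> bit"
  where "bordered a c y m v w =
    (if v = a then if w = a then c else y w else if w = a then y v else m v w)"

text \<open>These are the kernel equations of \<open>block\<close> for a vector split into
  \<open>p\<close> and \<open>q\<close>. Since the off-diagonal blocks are products, each half sees
  the other only through one bit, \<open>x \<cdot> p\<close> or \<open>y \<cdot> q\<close>.\<close>

definition block_solutions where
  "block_solutions S\<^sub>1 S\<^sub>2 m x m' y = {(p, q). p \<in> supported S\<^sub>1 \<and> q \<in> supported S\<^sub>2 \<and>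
     (\<forall>v\<in>S\<^sub>1. (\<Sum>w\<in>S\<^sub>1. m v w * p w) + x v * (\<Sum>w\<in>S\<^sub>2. y w * q w) = 0) \<and>
     (\<forall>v\<in>S\<^sub>2. y v * (\<Sum>w\<in>S\<^sub>1. x w * p w) + (\<Sum>w\<in>S\<^sub>2. m' v w * q w) = 0)}"

text \<open>The same for \<open>bordered\<close>, where \<open>t\<close> is the coordinate at
  \<open>a\<close>.\<close>

definition bordered_solutions where
  "bordered_solutions c S m y = {(t, q). q \<in> supported S \<and>
     c * t + (\<Sum>w\<in>S. y w * q w) = 0 \<and>
     (\<forall>v\<in>S. y v * t + (\<Sum>w\<in>S. m v w * q w) = 0)}"

lemma card_null_space_block:
  assumes fin: "finite S\<^sub>1" "finite S\<^sub>2" and disj: "S\<^sub>1 \<inter> S\<^sub>2 = {}"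
  shows "card (null_space (S\<^sub>1 \<union> S\<^sub>2) (block S\<^sub>1 m x m' y)) = card (block_solutions S\<^sub>1 S\<^sub>2 m x m' y)"
proof -
  let ?join = "\<lambda>(p, q) v. if v \<in> S\<^sub>1 then p v else q v :: bit"
  let ?split = "\<lambda>f. (\<lambda>v. if v \<in> S\<^sub>1 then f v else 0, \<lambda>v. if v \<in> S\<^sub>1 then 0 else f v :: bit)"
  have not1: "w \<notin> S\<^sub>1" if "w \<in> S\<^sub>2" for w using that disj by blast
  have sum: "(\<Sum>w\<in>S\<^sub>1 \<union> S\<^sub>2. block S\<^sub>1 m x m' y v w * f w) =
      (if v \<in> S\<^sub>1 then (\<Sum>w\<in>S\<^sub>1. m v w * f w) + x v * (\<Sum>w\<in>S\<^sub>2. y w * f w)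
       else y v * (\<Sum>w\<in>S\<^sub>1. x w * f w) + (\<Sum>w\<in>S\<^sub>2. m' v w * f w))" for v f
    using not1 by (simp add: sum.union_disjoint[OF fin disj] block_def sum_distrib_left mult.assoc
        cong: sum.cong)
  have "bij_betw ?join (block_solutions S\<^sub>1 S\<^sub>2 m x m' y) (null_space (S\<^sub>1 \<union> S\<^sub>2) (block S\<^sub>1 m x m' y))"
  proof (rule bij_betw_byWitness[where f' = ?split])
    show "\<forall>pq\<in>block_solutions S\<^sub>1 S\<^sub>2 m x m' y. ?split (?join pq) = pq"
      using not1 by (fastforce simp: block_solutions_def supported_def fun_eq_iff)
    show "\<forall>f\<in>null_space (S\<^sub>1 \<union> S\<^sub>2) (block S\<^sub>1 m x m' y). ?join (?split f) = f"
      by auto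
    show "?join ` block_solutions S\<^sub>1 S\<^sub>2 m x m' y \<subseteq> null_space (S\<^sub>1 \<union> S\<^sub>2) (block S\<^sub>1 m x m' y)"
      using not1 by (auto simp: block_solutions_def null_space_def sum supported_def cong: sum.cong)
    show "?split ` null_space (S\<^sub>1 \<union> S\<^sub>2) (block S\<^sub>1 m x m' y) \<subseteq> block_solutions S\<^sub>1 S\<^sub>2 m x m' y"
    proof -
      have "?split f \<in> block_solutions S\<^sub>1 S\<^sub>2 m x m' y"
        if f: "f \<in> null_space (S\<^sub>1 \<union> S\<^sub>2) (block S\<^sub>1 m x m' y)" for f
      proof -
        have "f v = 0" if "v \<notin> S\<^sub>1" "v \<notin> S\<^sub>2" for v
          using f that by (simp add: null_space_def supported_def)
        moreover have "(\<Sum>w\<in>S\<^sub>1. m v w * f w) + x v * (\<Sum>w\<in>S\<^sub>2. y w * f w) = 0" if "v \<in> S\<^sub>1" for v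
          using f that by (simp add: null_space_def sum ball_Un)
        moreover have "y v * (\<Sum>w\<in>S\<^sub>1. x w * f w) + (\<Sum>w\<in>S\<^sub>2. m' v w * f w) = 0" if "v \<in> S\<^sub>2" for v
          using f that not1 by (simp add: null_space_def sum ball_Un)
        ultimately show ?thesis
          using not1 by (auto simp: block_solutions_def supported_def cong: sum.cong)
      qed
      then show ?thesis by blast
    qed
  qed
  then show ?thesis by (simp add: bij_betw_same_card)
qed

lemma card_null_space_bordered:
  assumes fin: "finite S" and a: "a \<notin> S"
  shows "card (null_space (insert a S) (bordered a c y m)) = card (bordered_solutions c S m y)"
proof -
  have ne: "w \<noteq> a" if "w \<in> S" for w using that a by blast
  have sum: "(\<Sum>w\<in>insert a S. bordered a c y m v w * f w) =
      (if v = a then c * f a + (\<Sum>w\<in>S. y w * f w)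
       else y v * f a + (\<Sum>w\<in>S. m v w * f w))" for v f
    using fin a ne by (simp add: bordered_def cong: sum.cong)
  have "bij_betw (\<lambda>(t, q). q(a := t)) (bordered_solutions c S m y)
          (null_space (insert a S) (bordered a c y m))"
  proof (rule bij_betw_byWitness[where f' = "\<lambda>f. (f a, f(a := 0))"])
    show "\<forall>tq\<in>bordered_solutions c S m y.
        ((case tq of (t, q) \<Rightarrow> q(a := t)) a, (case tq of (t, q) \<Rightarrow> q(a := t))(a := 0)) = tq"
      using a by (auto simp: bordered_solutions_def supported_def)
    show "\<forall>f\<in>null_space (insert a S) (bordered a c y m). (case (f a, f(a := 0)) of (t, q) \<Rightarrow> q(a := t)) = f"
      by auto
    show "(\<lambda>(t, q). q(a := t)) ` bordered_solutions c S m y \<subseteq> null_space (insert a S) (bordered a c y m)"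
      using ne by (auto simp: bordered_solutions_def null_space_def sum supported_def cong: sum.cong)
    show "(\<lambda>f. (f a, f(a := 0))) ` null_space (insert a S) (bordered a c y m) \<subseteq> bordered_solutions c S m y"
    proof -
      have "(f a, f(a := 0)) \<in> bordered_solutions c S m y"
        if f: "f \<in> null_space (insert a S) (bordered a c y m)" for f
      proof -
        have "f v = 0" if "v \<notin> S" "v \<noteq> a" for v
          using f that by (simp add: null_space_def supported_def)
        moreover have "c * f a + (\<Sum>w\<in>S. y w * f w) = 0"
          using f by (auto simp: null_space_def sum)
        moreover have "y v * f a + (\<Sum>w\<in>S. m v w * f w) = 0" if "v \<in> S" for v
          using f that ne by (auto simp: null_space_def sum)
        ultimately show ?thesis
          using ne by (auto simp: bordered_solutions_def supported_def cong: sum.cong)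
      qed
      then show ?thesis by blast
    qed
  qed
  then show ?thesis by (simp add: bij_betw_same_card)
qed

text \<open>
  If \<open>x\<close> is not orthogonal to the kernel of \<open>m\<close>, then that kernel is the disjoint union of
  \<open>K\<^sub>0 = {p. x \<cdot> p = 0}\<close> and a translate of it, which accounts for the factor 2.
\<close>

lemma card_block_solutions_non_orthogonal:
  fixes m :: "'v \<Rightarrow> 'v \<Rightarrow> bit"
  assumes p1: "p\<^sub>1 \<in> null_space S\<^sub>1 m" and dot1: "(\<Sum>v\<in>S\<^sub>1. x v * p\<^sub>1 v) = 1"
    and sym: "\<And>v w. v \<in> S\<^sub>1 \<Longrightarrow> w \<in> S\<^sub>1 \<Longrightarrow> m v w = m w v"
  shows "2 * card (block_solutions S\<^sub>1 S\<^sub>2 m x m' y) =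
         card (null_space S\<^sub>1 m) * card (bordered_solutions 0 S\<^sub>2 m' y)"
proof -
  let ?K0 = "{p \<in> null_space S\<^sub>1 m. (\<Sum>v\<in>S\<^sub>1. x v * p v) = 0}"
  \<comment> \<open>For fixed \<open>t\<close> this is an involution in characteristic 2, and it
    changes \<open>x \<cdot> p\<close> by \<open>t\<close>. Hence \<open>shift (dot p) p\<close>
    moves a kernel vector into \<open>?K0\<close>.\<close>
  define shift where "shift t p v = p v + t * p\<^sub>1 v" for t p v
  define dot where "dot p = (\<Sum>v\<in>S\<^sub>1. x v * p v)" for p
  have shift_null: "shift t p \<in> null_space S\<^sub>1 m" if "p \<in> null_space S\<^sub>1 m" for t p
    using p1 that by (cases t)
      (auto simp: null_space_def supported_def shift_def distrib_left sum.distrib)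
  have dot_shift: "dot (shift t p) = dot p + t" for t p
    using dot1 by (cases t) (auto simp: dot_def shift_def distrib_left sum.distrib)
  have shift_shift: "shift t (shift t p) = p" for t p
    by (simp add: shift_def add.assoc fun_eq_iff)
  have K0: "p \<in> ?K0 \<longleftrightarrow> p \<in> null_space S\<^sub>1 m \<and> dot p = 0" for p
    by (simp add: dot_def)
  \<comment> \<open>Pairing the upper equations with \<open>p\<^sub>1\<close> annihilates
    \<open>m\<close> by symmetry and leaves \<open>(x \<cdot> p\<^sub>1) (y \<cdot> q) = 0\<close>.
    Then \<open>y \<cdot> q = 0\<close>, and the upper equations reduce to
    \<open>m p = 0\<close>.\<close>
  have orth: "(\<Sum>w\<in>S\<^sub>2. y w * q w) = 0" and null: "p \<in> null_space S\<^sub>1 m"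
    if "(p, q) \<in> block_solutions S\<^sub>1 S\<^sub>2 m x m' y" for p q
  proof -
    let ?s = "\<Sum>w\<in>S\<^sub>2. y w * q w"
    have eq: "(\<Sum>w\<in>S\<^sub>1. m v w * p w) = x v * ?s" if "v \<in> S\<^sub>1" for v
      using \<open>(p, q) \<in> _\<close> that unfolding block_solutions_def
      by (auto simp: add_eq_0_iff)
    have "0 = (\<Sum>w\<in>S\<^sub>1. (\<Sum>v\<in>S\<^sub>1. m w v * p\<^sub>1 v) * p w)"
      using p1 by (simp add: null_space_def)
    also have "\<dots> = (\<Sum>w\<in>S\<^sub>1. \<Sum>v\<in>S\<^sub>1. p\<^sub>1 v * (m v w * p w))"
      by (auto simp: sum_distrib_left sum_distrib_right sym mult_ac intro!: sum.cong)
    also have "\<dots> = (\<Sum>v\<in>S\<^sub>1. p\<^sub>1 v * (x v * ?s))"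
      by (subst sum.swap) (auto simp: eq simp flip: sum_distrib_left intro!: sum.cong)
    also have "\<dots> = dot p\<^sub>1 * ?s"
      unfolding dot_def sum_distrib_right[of _ _ ?s] by (simp only: mult_ac)
    finally show "?s = 0" using dot1 by (simp add: dot_def)
    then show "p \<in> null_space S\<^sub>1 m"
      using \<open>(p, q) \<in> _\<close> eq by (auto simp: null_space_def block_solutions_def)
  qed
  have "bij_betw (\<lambda>(p, t). shift t p) (?K0 \<times> UNIV) (null_space S\<^sub>1 m)"
    by (rule bij_betw_byWitness[where f' = "\<lambda>p. (shift (dot p) p, dot p)"])
       (auto simp: K0 shift_null dot_shift shift_shift simp flip: dot_def)
  from bij_betw_same_card[OF this] have card_null: "card (null_space S\<^sub>1 m) = card ?K0 * 2"
    by (simp only: card_cartesian_product card_UNIV_bit)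
  \<comment> \<open>The coordinate \<open>t\<close> at \<open>a\<close> records
    \<open>x \<cdot> p\<close>. The row of \<open>a\<close> in the bordered system says
    \<open>y \<cdot> q = 0\<close>, and its other rows are the lower equations of the block
    system.\<close>
  have "bij_betw (\<lambda>(p, (t, q)). (shift t p, q)) (?K0 \<times> bordered_solutions 0 S\<^sub>2 m' y)
      (block_solutions S\<^sub>1 S\<^sub>2 m x m' y)"
  proof (rule bij_betw_byWitness[where f' = "\<lambda>(p, q). (shift (dot p) p, (dot p, q))"])
    show "\<forall>z\<in>?K0 \<times> bordered_solutions 0 S\<^sub>2 m' y.
        (\<lambda>(p, q). (shift (dot p) p, (dot p, q))) (case z of (p, t, q) \<Rightarrow> (shift t p, q)) = z"
      by (auto simp: K0 dot_shift shift_shift simp flip: dot_def)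
    show "\<forall>z\<in>block_solutions S\<^sub>1 S\<^sub>2 m x m' y.
        (\<lambda>(p, t, q). (shift t p, q)) (case z of (p, q) \<Rightarrow> (shift (dot p) p, dot p, q)) = z"
      by (auto simp: shift_shift)
    show "(\<lambda>(p, t, q). (shift t p, q)) ` (?K0 \<times> bordered_solutions 0 S\<^sub>2 m' y)
        \<subseteq> block_solutions S\<^sub>1 S\<^sub>2 m x m' y"
    proof clarify
      fix p t q
      assume p: "p \<in> null_space S\<^sub>1 m" "(\<Sum>v\<in>S\<^sub>1. x v * p v) = 0"
        and q: "(t, q) \<in> bordered_solutions 0 S\<^sub>2 m' y"
      have "(\<Sum>v\<in>S\<^sub>1. x v * shift t p v) = t"
        using dot_shift[of t p] p(2) by (simp add: dot_def)
      then show "(shift t p, q) \<in> block_solutions S\<^sub>1 S\<^sub>2 m x m' y"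
        using shift_null[OF p(1), of t] q
        by (simp add: block_solutions_def bordered_solutions_def null_space_def)
    qed
    show "(\<lambda>(p, q). (shift (dot p) p, dot p, q)) ` block_solutions S\<^sub>1 S\<^sub>2 m x m' y
        \<subseteq> ?K0 \<times> bordered_solutions 0 S\<^sub>2 m' y"
    proof (rule image_subsetI, unfold split_paired_all prod.case)
      fix p q assume pq: "(p, q) \<in> block_solutions S\<^sub>1 S\<^sub>2 m x m' y"
      have "(dot p, q) \<in> bordered_solutions 0 S\<^sub>2 m' y"
        using pq orth[OF pq] by (simp add: block_solutions_def bordered_solutions_def dot_def)
      moreover have "shift (dot p) p \<in> ?K0"
        unfolding K0 using null[OF pq] by (simp add: shift_null dot_shift)
      ultimately show "(shift (dot p) p, dot p, q) \<in> ?K0 \<times> bordered_solutions 0 S\<^sub>2 m' y"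
        by blast
    qed
  qed
  from bij_betw_same_card[OF this]
  have "card (block_solutions S\<^sub>1 S\<^sub>2 m x m' y) = card ?K0 * card (bordered_solutions 0 S\<^sub>2 m' y)"
    by (simp only: card_cartesian_product)
  then show ?thesis using card_null by simp
qed

text \<open>With \<open>x = m u\<close> the upper equations say that
  \<open>p + (y \<cdot> q) u\<close> lies in the kernel of \<open>m\<close>. Orthogonality then
  gives \<open>x \<cdot> p = c (y \<cdot> q)\<close>, so the lower equations involve
  \<open>q\<close> alone, and each admissible \<open>q\<close> leaves a coset of that kernel for
  \<open>p\<close>.\<close>

lemma card_block_solutions_range:
  fixes m :: "'v \<Rightarrow> 'v \<Rightarrow> bit"
  assumes u: "u \<in> supported S\<^sub>1" and mu: "\<And>v. v \<in> S\<^sub>1 \<Longrightarrow> (\<Sum>w\<in>S\<^sub>1. m v w * u w) = x v"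
    and orth: "\<And>p. p \<in> null_space S\<^sub>1 m \<Longrightarrow> (\<Sum>v\<in>S\<^sub>1. x v * p v) = 0"
  defines "c \<equiv> \<Sum>v\<in>S\<^sub>1. x v * u v"
  shows "card (block_solutions S\<^sub>1 S\<^sub>2 m x m' y) = card (null_space S\<^sub>1 m) *
     card {q \<in> supported S\<^sub>2. \<forall>v\<in>S\<^sub>2. y v * (c * (\<Sum>w\<in>S\<^sub>2. y w * q w)) + (\<Sum>w\<in>S\<^sub>2. m' v w * q w) = 0}"
    (is "_ = _ * card ?Q")
proof -
  define shift where "shift t p v = p v + t * u v" for t p v
  define s where "s q = (\<Sum>w\<in>S\<^sub>2. y w * q w)" for q
  have m_shift: "(\<Sum>w\<in>S\<^sub>1. m v w * shift t p w) = (\<Sum>w\<in>S\<^sub>1. m v w * p w) + x v * t" if "v \<in> S\<^sub>1" for v t p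
    using mu[OF that] by (cases t) (simp_all add: shift_def distrib_left sum.distrib)
  have dot_shift: "(\<Sum>v\<in>S\<^sub>1. x v * shift t p v) = (\<Sum>v\<in>S\<^sub>1. x v * p v) + c * t" for t p
    by (cases t) (simp_all add: c_def shift_def distrib_left sum.distrib)
  have shift_supp: "shift t p \<in> supported S\<^sub>1" if "p \<in> supported S\<^sub>1" for t p
    using that u by (auto simp: shift_def supported_def)
  have shift_shift: "shift t (shift t p) = p" for t p
    by (simp add: shift_def add.assoc fun_eq_iff)
  have null: "shift (s q) p \<in> null_space S\<^sub>1 m" if "(p, q) \<in> block_solutions S\<^sub>1 S\<^sub>2 m x m' y" for p q
    using that by (auto simp: block_solutions_def null_space_def shift_supp m_shift s_def)
  \<comment> \<open>The shift depends only on \<open>q\<close>, which the map fixes, so the map is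
    its own inverse.\<close>
  have "bij_betw (\<lambda>(p, q). (shift (s q) p, q)) (null_space S\<^sub>1 m \<times> ?Q) (block_solutions S\<^sub>1 S\<^sub>2 m x m' y)"
  proof (rule bij_betw_byWitness[where f' = "\<lambda>(p, q). (shift (s q) p, q)"])
    show "(\<lambda>(p, q). (shift (s q) p, q)) ` (null_space S\<^sub>1 m \<times> ?Q) \<subseteq> block_solutions S\<^sub>1 S\<^sub>2 m x m' y"
    proof clarify
      fix p q
      assume p: "p \<in> null_space S\<^sub>1 m" and q: "q \<in> supported S\<^sub>2"
        "\<forall>v\<in>S\<^sub>2. y v * (c * (\<Sum>w\<in>S\<^sub>2. y w * q w)) + (\<Sum>w\<in>S\<^sub>2. m' v w * q w) = 0"
      then show "(shift (s q) p, q) \<in> block_solutions S\<^sub>1 S\<^sub>2 m x m' y"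
        using orth[OF p]
        by (simp add: block_solutions_def dot_shift m_shift null_space_def shift_supp s_def add.assoc)
    qed
    show "(\<lambda>(p, q). (shift (s q) p, q)) ` block_solutions S\<^sub>1 S\<^sub>2 m x m' y \<subseteq> null_space S\<^sub>1 m \<times> ?Q"
    proof (rule image_subsetI, unfold split_paired_all prod.case)
      fix p q assume pq: "(p, q) \<in> block_solutions S\<^sub>1 S\<^sub>2 m x m' y"
      have "(\<Sum>v\<in>S\<^sub>1. x v * p v) + c * s q = 0"
        using orth[OF null[OF pq]] by (simp add: dot_shift)
      then have "(\<Sum>v\<in>S\<^sub>1. x v * p v) = c * s q"
        by (simp add: add_eq_0_iff)
      then show "(shift (s q) p, q) \<in> null_space S\<^sub>1 m \<times> ?Q"
        using null[OF pq] pq by (simp add: block_solutions_def s_def)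
    qed
  qed (auto simp: shift_shift)
  from bij_betw_same_card[OF this] show ?thesis
    by (simp only: card_cartesian_product)
qed

lemma nullity_block_non_orthogonal:
  fixes m :: "'v \<Rightarrow> 'v \<Rightarrow> bit"
  assumes fin: "finite S\<^sub>1" "finite S\<^sub>2" and disj: "S\<^sub>1 \<inter> S\<^sub>2 = {}" and a: "a \<notin> S\<^sub>2"
    and sym: "\<And>v w. v \<in> S\<^sub>1 \<Longrightarrow> w \<in> S\<^sub>1 \<Longrightarrow> m v w = m w v"
    and p: "p \<in> null_space S\<^sub>1 m" "(\<Sum>v\<in>S\<^sub>1. x v * p v) = 1"
  shows "nullity (S\<^sub>1 \<union> S\<^sub>2) (block S\<^sub>1 m x m' y) =
     (nullity S\<^sub>1 m - 1) + nullity (insert a S\<^sub>2) (bordered a 0 y m')"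
proof -
  have "2 * 2 ^ nullity (S\<^sub>1 \<union> S\<^sub>2) (block S\<^sub>1 m x m' y) =
      (2 ^ nullity S\<^sub>1 m * 2 ^ nullity (insert a S\<^sub>2) (bordered a 0 y m') :: nat)"
    using card_block_solutions_non_orthogonal[OF p sym, of S\<^sub>2 m' y] fin disj a
    by (simp add: card_null_space_block card_null_space_bordered flip: card_null_space)
  then have "(2::nat) ^ Suc (nullity (S\<^sub>1 \<union> S\<^sub>2) (block S\<^sub>1 m x m' y)) =
      2 ^ (nullity S\<^sub>1 m + nullity (insert a S\<^sub>2) (bordered a 0 y m'))"
    by (simp only: power_Suc power_add)
  then have sum: "Suc (nullity (S\<^sub>1 \<union> S\<^sub>2) (block S\<^sub>1 m x m' y)) =
      nullity S\<^sub>1 m + nullity (insert a S\<^sub>2) (bordered a 0 y m')"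
    by (rule power_inject_exp[THEN iffD1, rotated]) simp
  \<comment> \<open>The vector \<open>p\<close> is a nonzero kernel vector, so the subtraction of 1
    in the conclusion is not truncated.\<close>
  have "nullity S\<^sub>1 m \<noteq> 0"
  proof
    assume "nullity S\<^sub>1 m = 0"
    then have "card (null_space S\<^sub>1 m) = 1"
      using card_null_space[OF fin(1), of m] by simp
    moreover have "(\<lambda>v. 0) \<in> null_space S\<^sub>1 m"
      by (simp add: null_space_def supported_def)
    ultimately have "p = (\<lambda>v. 0)"
      using p(1) by (metis card_1_singletonE singletonD)
    then show False using p(2) by simp
  qed
  then show ?thesis using sum by simp
qed

lemma nullity_block_range:
  fixes m :: "'v \<Rightarrow> 'v \<Rightarrow> bit"
  assumes fin: "finite S\<^sub>1" "finite S\<^sub>2" and disj: "S\<^sub>1 \<inter> S\<^sub>2 = {}" and a: "a \<notin> S\<^sub>2"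
    and u: "u \<in> supported S\<^sub>1" and mu: "\<And>v. v \<in> S\<^sub>1 \<Longrightarrow> (\<Sum>w\<in>S\<^sub>1. m v w * u w) = x v"
    and orth: "\<And>p. p \<in> null_space S\<^sub>1 m \<Longrightarrow> (\<Sum>v\<in>S\<^sub>1. x v * p v) = 0"
  shows "nullity (S\<^sub>1 \<union> S\<^sub>2) (block S\<^sub>1 m x m' y) = nullity S\<^sub>1 m +
     (if (\<Sum>v\<in>S\<^sub>1. x v * u v) = 0 then nullity S\<^sub>2 m' else nullity (insert a S\<^sub>2) (bordered a 1 y m'))"
proof -
  let ?c = "\<Sum>v\<in>S\<^sub>1. x v * u v"
  let ?Q = "{q \<in> supported S\<^sub>2. \<forall>v\<in>S\<^sub>2. y v * (?c * (\<Sum>w\<in>S\<^sub>2. y w * q w)) + (\<Sum>w\<in>S\<^sub>2. m' v w * q w) = 0}"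
  let ?n = "if ?c = 0 then nullity S\<^sub>2 m' else nullity (insert a S\<^sub>2) (bordered a 1 y m')"
  have "card ?Q = 2 ^ ?n"
  proof (cases "?c = 0")
    case True
    then have "?Q = null_space S\<^sub>2 m'"
      by (simp add: null_space_def)
    then show ?thesis using True fin by (simp add: card_null_space)
  next
    case False
    then have c: "?c = 1" by simp
    \<comment> \<open>With corner 1 the row of \<open>a\<close> forces
      \<open>t = y \<cdot> q\<close>, so a bordered solution is determined by
      \<open>q\<close>.\<close>
    have "bij_betw (\<lambda>q. (\<Sum>w\<in>S\<^sub>2. y w * q w, q)) ?Q (bordered_solutions 1 S\<^sub>2 m' y)"
      unfolding c by (rule bij_betw_byWitness[where f' = snd])
        (auto simp: bordered_solutions_def add_eq_0_iff)
    then show ?thesis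
      using c fin a by (simp add: card_null_space_bordered bij_betw_same_card flip: card_null_space)
  qed
  then have "card (null_space (S\<^sub>1 \<union> S\<^sub>2) (block S\<^sub>1 m x m' y)) = 2 ^ (nullity S\<^sub>1 m + ?n)"
    using card_block_solutions_range[of u S\<^sub>1 m x S\<^sub>2 m' y, OF u mu orth]
    by (simp only: card_null_space_block[OF fin disj] card_null_space[OF fin(1)] power_add)
  then show ?thesis by (rule nullity_eqI)
qed

text \<open>The order of the quantifiers carries the universality: the case distinction looks only
  at the first block, so the coefficients are fixed before the second block is given.\<close>

lemma power_nullity_block:
  fixes d :: "'r::comm_ring_1" and m :: "'v \<Rightarrow> 'v \<Rightarrow> bit"
  assumes fin1: "finite S\<^sub>1" and sym: "\<And>v w. v \<in> S\<^sub>1 \<Longrightarrow> w \<in> S\<^sub>1 \<Longrightarrow> m v w = m w v"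
  shows "\<exists>k\<^sub>0 k\<^sub>1 k\<^sub>m :: 'r. \<forall>S\<^sub>2 m' y. finite S\<^sub>2 \<longrightarrow> S\<^sub>1 \<inter> S\<^sub>2 = {} \<longrightarrow> a \<notin> S\<^sub>2 \<longrightarrow>
     d ^ nullity (S\<^sub>1 \<union> S\<^sub>2) (block S\<^sub>1 m x m' y) =
       k\<^sub>0 * d ^ nullity (insert a S\<^sub>2) (bordered a 0 y m') +
       k\<^sub>1 * d ^ nullity (insert a S\<^sub>2) (bordered a 1 y m') +
       k\<^sub>m * d ^ nullity S\<^sub>2 m'"
proof (cases "\<exists>p\<in>null_space S\<^sub>1 m. (\<Sum>v\<in>S\<^sub>1. x v * p v) = 1")
  case True
  then obtain p where p: "p \<in> null_space S\<^sub>1 m" "(\<Sum>v\<in>S\<^sub>1. x v * p v) = 1" by blast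
  show ?thesis
    by (rule exI[of _ "d ^ (nullity S\<^sub>1 m - 1)"], rule exI[of _ 0], rule exI[of _ 0])
      (auto simp: nullity_block_non_orthogonal[OF fin1 _ _ _ sym p] power_add)
next
  case False
  then have orth: "(\<Sum>v\<in>S\<^sub>1. x v * p v) = 0" if "p \<in> null_space S\<^sub>1 m" for p
    using that by auto
  obtain u where u: "u \<in> supported S\<^sub>1" "\<And>v. v \<in> S\<^sub>1 \<Longrightarrow> (\<Sum>w\<in>S\<^sub>1. m v w * u w) = x v"
    using fredholm_alternative[of S\<^sub>1 m x, OF fin1 sym orth] by blast
  note nullity = nullity_block_range[OF fin1 _ _ _ u orth]
  let ?k = "d ^ nullity S\<^sub>1 m"
  show ?thesis
  proof (cases "(\<Sum>v\<in>S\<^sub>1. x v * u v) = 0")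
    case True
    then show ?thesis
      by (intro exI[of _ 0] exI[of _ ?k] allI impI) (simp add: nullity power_add)
  next
    case False
    show ?thesis
      by (rule exI[of _ 0], rule exI[of _ ?k], rule exI[of _ 0])
        (use False in \<open>simp add: nullity power_add\<close>)
  qed
qed

section \<open>Brackets of compositions\<close>

text \<open>Together with \<open>kept\<close> this describes \<open>adjacency_matrix_at\<close>
  without an enumeration: here are the entries, there the rows and columns that survive
  deletion.\<close>

definition toggled_adjacency :: "('v, 'l, 'r) wm_graph \<Rightarrow> 'v set \<Rightarrow> 'v \<Rightarrow> 'v \<Rightarrow> bit" where
  "toggled_adjacency G T v w =
     (if v = w then of_bool (looped G v) + of_bool (v \<in> T) else of_bool (neighbor G v w))"

definition kept :: "('v, 'l, 'r) wm_graph \<Rightarrow> 'v set \<Rightarrow> 'v set" where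
  "kept G T = {v \<in> verts G. \<not> (v \<in> marked G \<and> toggled_adjacency G T v v = 0)}"

text \<open>Following \<open>pick I\<close> by the vertex list enumerates the kept vertices, and
  along this enumeration the submatrix has the entries of \<open>toggled_adjacency\<close>.\<close>

lemma kernel_dim_adjacency_matrix_at:
  assumes "finite (verts G)"
  shows "kernel_dim (adjacency_matrix_at G (vertex_enum G) T) =
         nullity (kept G T) (toggled_adjacency G T)"
proof -
  let ?vs = "vertex_enum G"
  have "distinct ?vs \<and> set ?vs = verts G"
    unfolding vertex_enum_def by (rule someI_ex) (use finite_distinct_list[OF assms] in blast)
  then have dist: "distinct ?vs" and set: "set ?vs = verts G" by auto
  define M where "M = toggle_diagonal (adjacency_matrix G ?vs) ?vs T"
  define I where "I = {i. i < length ?vs \<and> \<not> (?vs ! i \<in> marked G \<and> M $$ (i, i) = 0)}"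
  have M: "M \<in> carrier_mat (length ?vs) (length ?vs)"
    by (auto simp: M_def toggle_diagonal_def adjacency_matrix_def)
  have entry: "M $$ (i, j) = toggled_adjacency G T (?vs ! i) (?vs ! j)"
    if "i < length ?vs" "j < length ?vs" for i j
    using that dist
    by (auto simp: M_def toggle_diagonal_def adjacency_matrix_def toggled_adjacency_def nth_eq_iff_index_eq)
  have Isub: "I \<subseteq> {..<length ?vs}" by (auto simp: I_def)
  have I_eq: "{i. i < length ?vs \<and> i \<in> I} = I" using Isub by auto
  have sub: "submatrix M I I = mat (card I) (card I) (\<lambda>(i, j). M $$ (pick I i, pick I j))"
    using M by (simp add: submatrix_def I_eq)
  have pick: "bij_betw (pick I) {..<card I} I"
    by (rule bij_betw_pick[OF Isub])
  have "bij_betw (\<lambda>i. ?vs ! i) I (kept G T)"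
  proof -
    have "(\<lambda>i. ?vs ! i) ` I = kept G T"
    proof -
      have "v \<in> (\<lambda>i. ?vs ! i) ` I" if "v \<in> kept G T" for v
      proof -
        have "v \<in> set ?vs" using that set by (simp add: kept_def)
        then obtain i where "i < length ?vs" "v = ?vs ! i" by (metis in_set_conv_nth)
        then show ?thesis using that by (auto simp: I_def kept_def entry)
      qed
      moreover have "?vs ! i \<in> kept G T" if "i \<in> I" for i
        using that nth_mem[of i ?vs] by (auto simp: I_def kept_def entry set)
      ultimately show ?thesis by auto
    qed
    moreover have "inj_on (\<lambda>i. ?vs ! i) I"
      using dist Isub by (auto simp: inj_on_def nth_eq_iff_index_eq subset_iff)
    ultimately show ?thesis by (simp add: bij_betw_def)
  qed
  from bij_betw_trans[OF pick this]
  have g: "bij_betw (\<lambda>i. ?vs ! pick I i) {..<card I} (kept G T)" by (simp add: o_def)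
  have lt: "pick I i < length ?vs" if "i < card I" for i
    using pick Isub that by (auto simp: bij_betw_def)
  have "card (mat_kernel (submatrix M I I)) = card (null_space (kept G T) (toggled_adjacency G T))"
    by (rule card_mat_kernel_eq_null_space[OF _ g]) (auto simp: sub entry lt)
  then have "nullity (kept G T) (toggled_adjacency G T) = kernel_dim (submatrix M I I)"
    by (intro nullity_eqI) (simp add: card_mat_kernel)
  then show ?thesis
    by (simp add: adjacency_matrix_at_def Let_def M_def I_def)
qed

lemma bracket_eq_nullity:
  assumes "finite (verts G)"
  shows "bracket d G = d ^ card (free_loops G) *
     (\<Sum>T\<in>Pow (verts G).
        (\<Prod>v\<in>verts G - T. alpha G v) * (\<Prod>t\<in>T. beta G t) *
        d ^ nullity (kept G T) (toggled_adjacency G T))"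
  unfolding bracket_def kernel_dim_adjacency_matrix_at[OF assms] ..

lemma neighbor_commute: "neighbor G v w \<longleftrightarrow> neighbor G w v"
  by (auto simp: neighbor_def insert_commute)

lemma toggled_adjacency_commute: "toggled_adjacency G T v w = toggled_adjacency G T w v"
  using neighbor_commute[of G v w] by (simp add: toggled_adjacency_def)

section \<open>Vertices, edges and matrices of a composition\<close>

lemma is_compositionD:
  assumes "is_composition A B a F H G"
  shows "finite (verts F)" "finite (verts H)" "finite (free_loops F)" "finite (free_loops H)"
    "marked F \<subseteq> verts F" "marked H \<subseteq> verts H"
    "\<And>e. e \<in># edges F \<Longrightarrow> e \<subseteq> verts F" "\<And>e. e \<in># edges H \<Longrightarrow> e \<subseteq> verts H"
    "verts F \<inter> verts H = {a}" "{a} \<notin># edges F" "{a} \<notin># edges H"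
    "a \<notin> marked F" "a \<notin> marked H"
    "verts G = (verts F - {a}) \<union> (verts H - {a})" "marked G = marked F \<union> marked H"
    "free_loops F \<inter> free_loops H = {}" "free_loops G = free_loops F \<union> free_loops H"
  using assms by (auto simp: is_composition_def wf_wm_graph_def plain_vertex_def looped_def)

text \<open>As \<open>a\<close> is unlooped in \<open>F\<close> and in \<open>H\<close>, each new
  edge has one end in \<open>F - a\<close> and the other in \<open>H - a\<close>. These vertex sets
  are disjoint, so old and new edges cannot be confused.\<close>

lemma composition_edges:
  assumes comp: "is_composition A B a F H G"
  shows "v \<in> verts F - {a} \<Longrightarrow> w \<in> verts F - {a} \<Longrightarrow> {v, w} \<in># edges G \<longleftrightarrow> {v, w} \<in># edges F"
    and "v \<in> verts H - {a} \<Longrightarrow> w \<in> verts H - {a} \<Longrightarrow> {v, w} \<in># edges G \<longleftrightarrow> {v, w} \<in># edges H"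
    and "v \<in> verts F - {a} \<Longrightarrow> w \<in> verts H - {a} \<Longrightarrow>
      {v, w} \<in># edges G \<longleftrightarrow> {v, a} \<in># edges F \<and> {a, w} \<in># edges H"
proof -
  note D = is_compositionD[OF comp]
  have mem: "e \<in># edges G \<longleftrightarrow> (e \<in># edges F \<and> a \<notin> e) \<or> (e \<in># edges H \<and> a \<notin> e) \<or>
      (\<exists>v w. e = {v, w} \<and> {v, a} \<in># edges F \<and> {a, w} \<in># edges H)" for e
  proof -
    obtain N where "edges G = edges (del_vertex F a) + edges (del_vertex H a) + N"
        "set_mset N = {{v, w} |v w. {v, a} \<in># edges F \<and> {a, w} \<in># edges H}"
      using comp by (auto simp: is_composition_def)
    then show ?thesis by (auto simp: del_vertex_def)
  qed
  have inF: "v \<in> verts F - {a}" if "{v, a} \<in># edges F" for v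
    using D(7)[OF that] that D(10) by auto
  have inH: "w \<in> verts H - {a}" if "{a, w} \<in># edges H" for w
    using D(8)[OF that] that D(11) by auto
  have disj: "v \<in> verts F - {a} \<Longrightarrow> v \<in> verts H - {a} \<Longrightarrow> False" for v
    using D(9) by auto
  have subF: "v \<in> verts F \<and> w \<in> verts F" if "{v, w} \<in># edges F" for v w
    using D(7)[OF that] by simp
  have subH: "v \<in> verts H \<and> w \<in> verts H" if "{v, w} \<in># edges H" for v w
    using D(8)[OF that] by simp
  show "{v, w} \<in># edges G \<longleftrightarrow> {v, w} \<in># edges F" if "v \<in> verts F - {a}" "w \<in> verts F - {a}"
  proof -
    have "{v, w} \<notin># edges H" using that subH disj by blast
    moreover have "\<not> (\<exists>v' w'. {v, w} = {v', w'} \<and> {v', a} \<in># edges F \<and> {a, w'} \<in># edges H)"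
      using that inH disj by (metis doubleton_eq_iff)
    ultimately show ?thesis using that unfolding mem by auto
  qed
  show "{v, w} \<in># edges G \<longleftrightarrow> {v, w} \<in># edges H" if "v \<in> verts H - {a}" "w \<in> verts H - {a}"
  proof -
    have "{v, w} \<notin># edges F" using that subF disj by blast
    moreover have "\<not> (\<exists>v' w'. {v, w} = {v', w'} \<and> {v', a} \<in># edges F \<and> {a, w'} \<in># edges H)"
      using that inF disj by (metis doubleton_eq_iff)
    ultimately show ?thesis using that unfolding mem by auto
  qed
  show "{v, w} \<in># edges G \<longleftrightarrow> {v, a} \<in># edges F \<and> {a, w} \<in># edges H"
    if "v \<in> verts F - {a}" "w \<in> verts H - {a}"
  proof -
    have "{v, w} \<notin># edges F" "{v, w} \<notin># edges H" using that subF subH disj by blast+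
    moreover have "(\<exists>v' w'. {v, w} = {v', w'} \<and> {v', a} \<in># edges F \<and> {a, w'} \<in># edges H) \<longleftrightarrow>
        {v, a} \<in># edges F \<and> {a, w} \<in># edges H"
      using that inF inH disj by (metis doubleton_eq_iff)
    ultimately show ?thesis unfolding mem by auto
  qed
qed

text \<open>Each side inherits its diagonal entries and marks, so whether a vertex is kept is
  decided in its own graph. The unmarked \<open>a\<close> is always kept in \<open>F\<close> and
  \<open>H\<close> and has to be removed explicitly.\<close>

lemma nullity_composition:
  assumes comp: "is_composition A B a F H G"
    and T: "T\<^sub>1 \<subseteq> verts F - {a}" "T\<^sub>2 \<subseteq> verts H - {a}"
  shows "nullity (kept G (T\<^sub>1 \<union> T\<^sub>2)) (toggled_adjacency G (T\<^sub>1 \<union> T\<^sub>2)) =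
    nullity ((kept F T\<^sub>1 - {a}) \<union> (kept H T\<^sub>2 - {a}))
      (block (kept F T\<^sub>1 - {a}) (toggled_adjacency F T\<^sub>1) (\<lambda>v. of_bool (neighbor F a v))
        (toggled_adjacency H T\<^sub>2) (\<lambda>v. of_bool (neighbor H a v)))"
proof -
  note D = is_compositionD[OF comp]
  let ?T = "T\<^sub>1 \<union> T\<^sub>2"
  have disj: "v \<in> verts F - {a} \<Longrightarrow> v \<notin> verts H - {a}" for v
    using D(9) by auto
  have F: "toggled_adjacency G ?T v w = toggled_adjacency F T\<^sub>1 v w"
    if "v \<in> verts F - {a}" "w \<in> verts F - {a}" for v w
    using composition_edges(1)[OF comp that] disj[of v] that T
    by (auto simp: toggled_adjacency_def looped_def neighbor_def)
  have H: "toggled_adjacency G ?T v w = toggled_adjacency H T\<^sub>2 v w"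
    if "v \<in> verts H - {a}" "w \<in> verts H - {a}" for v w
    using composition_edges(2)[OF comp that] disj[of v] that T
    by (auto simp: toggled_adjacency_def looped_def neighbor_def)
  have FH: "toggled_adjacency G ?T v w = of_bool (neighbor F a v) * of_bool (neighbor H a w)"
    if "v \<in> verts F - {a}" "w \<in> verts H - {a}" for v w
    using composition_edges(3)[OF comp that] disj[of v] that
    by (auto simp: toggled_adjacency_def neighbor_def insert_commute)
  have HF: "toggled_adjacency G ?T v w = of_bool (neighbor H a v) * of_bool (neighbor F a w)"
    if "v \<in> verts H - {a}" "w \<in> verts F - {a}" for v w
    using FH[OF that(2,1)] by (simp add: toggled_adjacency_commute[of G _ v] mult.commute)
  have kept: "kept G ?T = (kept F T\<^sub>1 - {a}) \<union> (kept H T\<^sub>2 - {a})"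
  proof -
    have "v \<in> kept G ?T \<longleftrightarrow> v \<in> kept F T\<^sub>1" if "v \<in> verts F - {a}" for v
      using that F[OF that that] disj[OF that] D(6) by (auto simp: kept_def D(14,15))
    moreover have "v \<in> kept G ?T \<longleftrightarrow> v \<in> kept H T\<^sub>2" if "v \<in> verts H - {a}" for v
      using that H[OF that that] disj[of v] D(5) by (auto simp: kept_def D(14,15))
    moreover have "kept G ?T \<subseteq> (verts F - {a}) \<union> (verts H - {a})"
      "kept F T\<^sub>1 \<subseteq> verts F" "kept H T\<^sub>2 \<subseteq> verts H"
      by (auto simp: kept_def D(14))
    ultimately show ?thesis by blast
  qed
  have in_verts: "v \<in> kept F T\<^sub>1 \<Longrightarrow> v \<in> verts F" "v \<in> kept H T\<^sub>2 \<Longrightarrow> v \<in> verts H" for v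
    by (simp_all add: kept_def)
  show ?thesis
    unfolding kept
  proof (rule nullity_cong)
    fix v w
    assume v: "v \<in> (kept F T\<^sub>1 - {a}) \<union> (kept H T\<^sub>2 - {a})"
      and w: "w \<in> (kept F T\<^sub>1 - {a}) \<union> (kept H T\<^sub>2 - {a})"
    show "toggled_adjacency G ?T v w =
      block (kept F T\<^sub>1 - {a}) (toggled_adjacency F T\<^sub>1) (\<lambda>v. of_bool (neighbor F a v))
        (toggled_adjacency H T\<^sub>2) (\<lambda>v. of_bool (neighbor H a v)) v w"
    proof -
      have "v \<in> verts F - {a}" if "v \<in> kept F T\<^sub>1 - {a}" for v
        using that in_verts by simp
      moreover have "v \<in> verts H - {a}" if "v \<notin> kept F T\<^sub>1 - {a}"
        "v \<in> (kept F T\<^sub>1 - {a}) \<union> (kept H T\<^sub>2 - {a})" for v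
        using that in_verts by blast
      ultimately show ?thesis
        using v w unfolding block_def by (metis F H FH HF)
    qed
  qed
qed

section \<open>Subset sums and vertex weights\<close>

lemma sum_Pow_Un:
  assumes "V\<^sub>1 \<inter> V\<^sub>2 = {}"
  shows "(\<Sum>T\<in>Pow (V\<^sub>1 \<union> V\<^sub>2). f T) = (\<Sum>T\<^sub>1\<in>Pow V\<^sub>1. \<Sum>T\<^sub>2\<in>Pow V\<^sub>2. f (T\<^sub>1 \<union> T\<^sub>2))"
proof -
  have "bij_betw (\<lambda>(T\<^sub>1, T\<^sub>2). T\<^sub>1 \<union> T\<^sub>2) (Pow V\<^sub>1 \<times> Pow V\<^sub>2) (Pow (V\<^sub>1 \<union> V\<^sub>2))"
    by (rule bij_betw_byWitness[where f' = "\<lambda>T. (T \<inter> V\<^sub>1, T \<inter> V\<^sub>2)"]) (use assms in auto)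
  from sum.reindex_bij_betw[OF this, of f] show ?thesis
    by (simp add: sum.cartesian_product case_prod_unfold)
qed

lemma sum_Pow_insert:
  assumes "finite V" "a \<notin> V"
  shows "(\<Sum>T\<in>Pow (insert a V). f T) = (\<Sum>T\<in>Pow V. f T) + (\<Sum>T\<in>Pow V. f (insert a T))"
proof -
  have "inj_on (insert a) (Pow V)" using assms(2) by (auto simp: inj_on_def)
  then show ?thesis
    unfolding Pow_insert using assms
    by (subst sum.union_disjoint) (auto simp: sum.reindex)
qed

text \<open>It is meant for \<open>T\<close> avoiding \<open>a\<close>: the weights of
  \<open>a\<close> are left out, so that they can be replaced freely.\<close>

definition weight :: "('v, 'l, 'r::comm_ring_1) wm_graph \<Rightarrow> 'v \<Rightarrow> 'v set \<Rightarrow> 'r" where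
  "weight G a T = (\<Prod>v\<in>verts G - {a} - T. alpha G v) * (\<Prod>t\<in>T. beta G t)"

text \<open>Pairing \<open>T\<close> with \<open>insert a T\<close> makes the bracket explicitly
  linear in the two weights of \<open>a\<close>.\<close>

lemma bracket_split_vertex:
  fixes H :: "('v, 'l, 'r::comm_ring_1) wm_graph"
  assumes fin: "finite (verts H)" and a: "a \<in> verts H"
  shows "bracket d H = d ^ card (free_loops H) * (\<Sum>T\<in>Pow (verts H - {a}).
     weight H a T * (alpha H a * d ^ nullity (kept H T) (toggled_adjacency H T) +
       beta H a * d ^ nullity (kept H (insert a T)) (toggled_adjacency H (insert a T))))"
proof -
  let ?V = "verts H - {a}"
  have V: "verts H = insert a ?V" using a by auto
  have out: "prod (alpha H) (verts H - T) * prod (beta H) T = weight H a T * alpha H a" if "T \<subseteq> ?V" for T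
  proof -
    have "verts H - T = insert a (?V - T)" using that a by auto
    then show ?thesis using fin by (simp add: weight_def mult_ac)
  qed
  have into: "prod (alpha H) (verts H - insert a T) * prod (beta H) (insert a T) = weight H a T * beta H a"
    if "T \<subseteq> ?V" for T
  proof -
    have "verts H - insert a T = ?V - T" by auto
    moreover have "finite T" "a \<notin> T" using that fin finite_subset[OF that] by auto
    ultimately show ?thesis by (simp add: weight_def mult_ac)
  qed
  have "(\<Sum>T\<in>Pow (verts H). f T) = (\<Sum>T\<in>Pow ?V. f T + f (insert a T))" for f :: "'v set \<Rightarrow> 'r"
    using sum_Pow_insert[of ?V a f] fin V by (simp add: sum.distrib)
  then show ?thesis
    unfolding bracket_eq_nullity[OF fin]
    by (simp only:) (intro arg_cong2[of _ _ _ _ "(*)"] sum.cong refl,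
        simp only: out into Pow_iff distrib_left mult.assoc)
qed

text \<open>Being unmarked, \<open>a\<close> is kept whether or not it is toggled; being unlooped,
  it has corner 0 before toggling and 1 after.\<close>

lemma bordered_toggled_adjacency:
  assumes "a \<in> verts H" "a \<notin> marked H" "\<not> looped H a" "T \<subseteq> verts H - {a}"
  defines "S \<equiv> kept H T - {a}"
  defines "N c \<equiv> nullity (insert a S) (bordered a c (\<lambda>v. of_bool (neighbor H a v)) (toggled_adjacency H T))"
  shows "nullity (kept H T) (toggled_adjacency H T) = N 0"
    and "nullity (kept H (insert a T)) (toggled_adjacency H (insert a T)) = N 1"
proof -
  have a: "a \<notin> T" using assms by auto
  have kept: "kept H T = insert a S" "kept H (insert a T) = insert a S"
    using assms(1,2) by (auto simp: kept_def S_def toggled_adjacency_def)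
  show "nullity (kept H T) (toggled_adjacency H T) = N 0"
    unfolding kept N_def using assms(3) a neighbor_commute[of H _ a]
    by (intro nullity_cong) (auto simp: bordered_def toggled_adjacency_def)
  show "nullity (kept H (insert a T)) (toggled_adjacency H (insert a T)) = N 1"
    unfolding kept N_def using assms(3) a neighbor_commute[of H _ a]
    by (intro nullity_cong) (auto simp: bordered_def toggled_adjacency_def)
qed

section \<open>Reweighting and marking a vertex\<close>

lemma toggled_adjacency_simps [simp]:
  "toggled_adjacency (set_weights H a x y) = toggled_adjacency H"
  "toggled_adjacency (mark_vertex H a) = toggled_adjacency H"
  by (auto simp: fun_eq_iff toggled_adjacency_def set_weights_def mark_vertex_def looped_def neighbor_def)

lemma kept_set_weights [simp]: "kept (set_weights H a x y) = kept H"
  by (auto simp: fun_eq_iff kept_def) (simp_all add: set_weights_def)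

text \<open>The diagonal entry of an unlooped, untoggled \<open>a\<close> is 0, so marking
  \<open>a\<close> deletes its row and column.\<close>

lemma kept_mark_vertex:
  assumes "\<not> looped H a" "T \<subseteq> verts H - {a}"
  shows "kept (mark_vertex H a) T = kept H T - {a}"
  using assms by (auto simp: kept_def mark_vertex_def toggled_adjacency_def subset_iff looped_def neighbor_def)

lemma set_weights_simps [simp]:
  "verts (set_weights H a x y) = verts H" "free_loops (set_weights H a x y) = free_loops H"
  "alpha (set_weights H a x y) a = x" "beta (set_weights H a x y) a = y"
  by (simp_all add: set_weights_def)

lemma mark_vertex_simps [simp]:
  "verts (mark_vertex H a) = verts H" "free_loops (mark_vertex H a) = free_loops H"
  "alpha (mark_vertex H a) = alpha H" "beta (mark_vertex H a) = beta H"
  by (simp_all add: mark_vertex_def)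

lemma weight_set_weights [simp]:
  assumes "T \<subseteq> verts H - {a}"
  shows "weight (set_weights H a x y) a T = weight H a T"
  unfolding weight_def using assms
  by (auto simp: set_weights_def intro!: arg_cong2[of _ _ _ _ "(*)"] prod.cong)

lemma weight_mark_vertex [simp]: "weight (mark_vertex H a) a T = weight H a T"
  by (simp add: weight_def)

lemma weight_composition:
  assumes comp: "is_composition A B a F H G"
    and T: "T\<^sub>1 \<subseteq> verts F - {a}" "T\<^sub>2 \<subseteq> verts H - {a}"
  shows "(\<Prod>v\<in>verts G - (T\<^sub>1 \<union> T\<^sub>2). alpha G v) * (\<Prod>t\<in>T\<^sub>1 \<union> T\<^sub>2. beta G t) =
     weight F a T\<^sub>1 * weight H a T\<^sub>2"
proof -
  note D = is_compositionD[OF comp]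
  have wF: "alpha G v = alpha F v" "beta G v = beta F v" if "v \<in> verts F - {a}" for v
    using comp that by (auto simp: is_composition_def)
  have wH: "alpha G v = alpha H v" "beta G v = beta H v" if "v \<in> verts H - {a}" for v
    using comp that by (auto simp: is_composition_def)
  have fin: "finite T\<^sub>1" "finite T\<^sub>2" using T D(1,2) by (auto intro: finite_subset)
  have "verts G - (T\<^sub>1 \<union> T\<^sub>2) = (verts F - {a} - T\<^sub>1) \<union> (verts H - {a} - T\<^sub>2)"
    using D(9,14) T by blast
  then have "prod (alpha G) (verts G - (T\<^sub>1 \<union> T\<^sub>2)) =
      prod (alpha G) (verts F - {a} - T\<^sub>1) * prod (alpha G) (verts H - {a} - T\<^sub>2)"
    using D(1,2,9) by (simp only:) (intro prod.union_disjoint; auto)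
  also have "\<dots> = prod (alpha F) (verts F - {a} - T\<^sub>1) * prod (alpha H) (verts H - {a} - T\<^sub>2)"
    by (intro arg_cong2[of _ _ _ _ "(*)"] prod.cong) (auto simp: wF wH)
  finally have alpha: "prod (alpha G) (verts G - (T\<^sub>1 \<union> T\<^sub>2)) = \<dots>" .
  have "prod (beta G) (T\<^sub>1 \<union> T\<^sub>2) = prod (beta G) T\<^sub>1 * prod (beta G) T\<^sub>2"
    using fin T D(9) by (intro prod.union_disjoint) auto
  also have "\<dots> = prod (beta F) T\<^sub>1 * prod (beta H) T\<^sub>2"
    using T by (intro arg_cong2[of _ _ _ _ "(*)"] prod.cong refl wF wH) auto
  finally show ?thesis by (simp add: alpha weight_def mult_ac)
qed

theorem theorem6:
  fixes A B d :: "'r::comm_ring_1"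
    and F :: "('v, 'l, 'r) wm_graph"
    and a :: 'v
  assumes "wf_wm_graph F"
    and "a \<in> verts F" and "\<not> looped F a" and "a \<notin> marked F"
    and "standard_weights A B F a"
  shows "\<exists>\<alpha>' \<beta>' \<alpha>\<^sub>m :: 'r. \<forall>H G :: ('v, 'l, 'r) wm_graph.
           is_composition A B a F H G \<and> (\<forall>w. neighbor H a w \<longrightarrow> w \<notin> marked H) \<longrightarrow>
           bracket d G = bracket d (set_weights H a \<alpha>' \<beta>')
                       + bracket d (set_weights (mark_vertex H a) a \<alpha>\<^sub>m 0)"
proof -
  let ?adj = "toggled_adjacency F" and ?S = "\<lambda>T. kept F T - {a}"
    and ?x = "\<lambda>v. of_bool (neighbor F a v) :: bit"
  have finS: "finite (?S T)" for T
    using assms(1) by (simp add: wf_wm_graph_def kept_def)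
  \<comment> \<open>Coefficients are chosen for every subset \<open>T\<close> on the side of
    \<open>F\<close> before any \<open>H\<close> is introduced.\<close>
  have "\<forall>T. \<exists>k\<^sub>0 k\<^sub>1 k\<^sub>m :: 'r. \<forall>S\<^sub>2 m' y. finite S\<^sub>2 \<longrightarrow> ?S T \<inter> S\<^sub>2 = {} \<longrightarrow> a \<notin> S\<^sub>2 \<longrightarrow>
     d ^ nullity (?S T \<union> S\<^sub>2) (block (?S T) (?adj T) ?x m' y) =
       k\<^sub>0 * d ^ nullity (insert a S\<^sub>2) (bordered a 0 y m') +
       k\<^sub>1 * d ^ nullity (insert a S\<^sub>2) (bordered a 1 y m') +
       k\<^sub>m * d ^ nullity S\<^sub>2 m'"
    by (intro allI power_nullity_block finS toggled_adjacency_commute)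
  then obtain k\<^sub>0 k\<^sub>1 k\<^sub>m :: "'v set \<Rightarrow> 'r" where k: "\<And>T S\<^sub>2 m' y. finite S\<^sub>2 \<Longrightarrow>
     ?S T \<inter> S\<^sub>2 = {} \<Longrightarrow> a \<notin> S\<^sub>2 \<Longrightarrow>
     d ^ nullity (?S T \<union> S\<^sub>2) (block (?S T) (?adj T) ?x m' y) =
       k\<^sub>0 T * d ^ nullity (insert a S\<^sub>2) (bordered a 0 y m') +
       k\<^sub>1 T * d ^ nullity (insert a S\<^sub>2) (bordered a 1 y m') +
       k\<^sub>m T * d ^ nullity S\<^sub>2 m'"
    unfolding choice_iff by blast
  \<comment> \<open>Summing the coefficients over all subsets of \<open>F - a\<close>, with their
    weights and the free loops of \<open>F\<close>, gives the three new weights of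
    \<open>a\<close>.\<close>
  define c where "c k = d ^ card (free_loops F) * (\<Sum>T\<in>Pow (verts F - {a}). weight F a T * k T)"
    for k :: "'v set \<Rightarrow> 'r"
  show ?thesis
  proof (rule exI[of _ "c k\<^sub>0"], rule exI[of _ "c k\<^sub>1"], rule exI[of _ "c k\<^sub>m"], intro allI impI)
    fix H G :: "('v, 'l, 'r) wm_graph"
    assume "is_composition A B a F H G \<and> (\<forall>w. neighbor H a w \<longrightarrow> w \<notin> marked H)"
    then have comp: "is_composition A B a F H G" by simp
    note D = is_compositionD[OF comp]
    have aH: "a \<in> verts H" using D(9) by auto
    have nloop: "\<not> looped H a" using D(11) by (simp add: looped_def)
    let ?VF = "verts F - {a}" and ?VH = "verts H - {a}"
    define N where "N b T = d ^ nullity (insert a (kept H T - {a}))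
      (bordered a b (\<lambda>v. of_bool (neighbor H a v)) (toggled_adjacency H T))" for b T
    define N\<^sub>m where "N\<^sub>m T = d ^ nullity (kept H T - {a}) (toggled_adjacency H T)" for T
    have finH: "finite (kept H T - {a})" for T
      using D(2) by (simp add: kept_def)
    have disj: "?S T\<^sub>1 \<inter> (kept H T\<^sub>2 - {a}) = {}" for T\<^sub>1 T\<^sub>2
      using D(9) by (auto simp: kept_def)
    have "bracket d G = d ^ card (free_loops G) * (\<Sum>T\<^sub>1\<in>Pow ?VF. \<Sum>T\<^sub>2\<in>Pow ?VH.
        weight F a T\<^sub>1 * weight H a T\<^sub>2 * (k\<^sub>0 T\<^sub>1 * N 0 T\<^sub>2 + k\<^sub>1 T\<^sub>1 * N 1 T\<^sub>2 + k\<^sub>m T\<^sub>1 * N\<^sub>m T\<^sub>2))"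
    proof -
      have fin: "finite (verts G)" using D(1,2,14) by simp
      have V: "Pow (verts G) = Pow (?VF \<union> ?VH)" using D(14) by simp
      have disjV: "?VF \<inter> ?VH = {}" using D(9) by auto
      show ?thesis
        unfolding bracket_eq_nullity[OF fin] V sum_Pow_Un[OF disjV]
        by (intro arg_cong[where f = "(*) _"] sum.cong refl)
          (simp only: Pow_iff weight_composition[OF comp] nullity_composition[OF comp]
            k[OF finH disj] N_def N\<^sub>m_def Diff_iff singletonI simp_thms)
    qed
    \<comment> \<open>After exchanging the sums, the inner sum over subsets of \<open>F - a\<close>
      becomes \<open>c\<close>. The free loops are disjoint, so their power of \<open>d\<close>
      factors.\<close>
    also have "\<dots> = d ^ card (free_loops H) * (\<Sum>T\<^sub>2\<in>Pow ?VH.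
        weight H a T\<^sub>2 * (c k\<^sub>0 * N 0 T\<^sub>2 + c k\<^sub>1 * N 1 T\<^sub>2)) +
        d ^ card (free_loops H) * (\<Sum>T\<^sub>2\<in>Pow ?VH. weight H a T\<^sub>2 * (c k\<^sub>m * N\<^sub>m T\<^sub>2))"
    proof -
      have "card (free_loops G) = card (free_loops F) + card (free_loops H)"
        using D(3,4,16,17) by (simp add: card_Un_disjoint)
      then show ?thesis
        by (subst sum.swap)
          (simp add: c_def sum_distrib_left sum_distrib_right sum.distrib power_add algebra_simps)
    qed
    \<comment> \<open>Corner 0 stands for the subsets without \<open>a\<close> and corner 1 for
      those with \<open>a\<close>.\<close>
    also have "d ^ card (free_loops H) * (\<Sum>T\<^sub>2\<in>Pow ?VH. weight H a T\<^sub>2 * (c k\<^sub>0 * N 0 T\<^sub>2 + c k\<^sub>1 * N 1 T\<^sub>2)) =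
        bracket d (set_weights H a (c k\<^sub>0) (c k\<^sub>1))"
      using D(2) aH
      by (subst bracket_split_vertex[of _ a])
        (auto simp: N_def bordered_toggled_adjacency[OF aH D(13) nloop] intro!: sum.cong
          arg_cong2[of _ _ _ _ "(*)"])
    \<comment> \<open>The weight \<beta> = 0 removes all subsets containing \<open>a\<close>; in the
      remaining ones the marked \<open>a\<close> is deleted.\<close>
    also have "d ^ card (free_loops H) * (\<Sum>T\<^sub>2\<in>Pow ?VH. weight H a T\<^sub>2 * (c k\<^sub>m * N\<^sub>m T\<^sub>2)) =
        bracket d (set_weights (mark_vertex H a) a (c k\<^sub>m) 0)"
      using D(2) aH
      by (subst bracket_split_vertex[of _ a])
        (auto simp: N\<^sub>m_def kept_mark_vertex[OF nloop] intro!: sum.cong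
          arg_cong2[of _ _ _ _ "(*)"])
    finally show "bracket d G = bracket d (set_weights H a (c k\<^sub>0) (c k\<^sub>1)) +
        bracket d (set_weights (mark_vertex H a) a (c k\<^sub>m) 0)" .
  qed
qed

end
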